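(* If $p,q>1$ are coprime integers, then $g(Q_{\{p,q\}}(x))=\min\{p,q\}-1$.
   Context: For coprime integers $p,q>1$, $Q_{\{p,q\}}(x)=\dfrac{(x^{pq}-1)(x-1)}{(x^p-1)(x^q-1)}$, which is a polynomial with integer coefficients (the binary inclusion-exclusion polynomial). For a nonzero polynomial $f=c_1x^{e_1}+\cdots+c_sx^{e_s}$ with all coefficients $c_i$ non-zero and $e_1<e_2<\cdots<e_s$, the maximum gap of $f$ is $g(f)=\max_{1\le i<s}(e_{i+1}-e_i)$, with $g(f)=0$ when $s=1$. *)

theory Defs
  imports "HOL-Computational_Algebra.Computational_Algebra"
begin

definition Q_numer :: "nat \<Rightarrow> nat \<Rightarrow> int poly" where
  "Q_numer p q = (monom 1 (p * q) - 1) * (monom 1 1 - 1)"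

definition Q_denom :: "nat \<Rightarrow> nat \<Rightarrow> int poly" where
  "Q_denom p q = (monom 1 p - 1) * (monom 1 q - 1)"

text \<open>The \<open>div\<close> of \<^typ>\<open>int poly\<close> is a true quotient only when the division is exact;
  lemma \<open>Q_poly_mult_denom\<close> below shows that it is for coprime \<open>p, q > 1\<close>.\<close>

definition Q_poly :: "nat \<Rightarrow> nat \<Rightarrow> int poly" where
  "Q_poly p q = Q_numer p q div Q_denom p q"

definition exponents :: "'a::zero poly \<Rightarrow> nat list" where
  "exponents f = sorted_list_of_set {e. coeff f e \<noteq> 0}"

text \<open>With \<open>exponents f = [e\<^sub>1, \<dots>, e\<^sub>s]\<close> the value is the maximum of the \<open>e\<^sub>i\<^sub>+\<^sub>1 - e\<^sub>i\<close>.
  The zero polynomial, for which the notion is not needed, also gets the value \<open>0\<close>.\<close>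

definition max_gap :: "'a::zero poly \<Rightarrow> nat" where
  "max_gap f =
     (if length (exponents f) \<le> 1 then 0
      else Max {exponents f ! (i + 1) - exponents f ! i | i. i + 1 < length (exponents f)})"

lemma Q_denom_dvd_numer:
  fixes p q :: nat
  assumes "p > 1" "q > 1" "coprime p q"
  shows "Q_denom p q dvd Q_numer p q"
proof -
  define X :: "nat \<Rightarrow> int poly" where "X n = monom 1 n - 1" for n
  have X_dvd: "X m dvd X (m * k)" for m k
  proof -
    have "monom 1 m - 1 dvd (monom 1 m) ^ k - (1 :: int poly)"
      using power_diff_1_eq[of "monom 1 m :: int poly" k] by simp
    thus ?thesis by (simp add: X_def monom_power)
  qed
  obtain a b where ab: "p * a = q * b + 1"
    using bezout_nat[of p q] assms by (auto simp: coprime_iff_gcd_eq_1)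
  have "X 1 = X (p * a) - monom 1 1 * X (q * b)"
    unfolding ab by (simp add: X_def right_diff_distrib mult_monom)
  hence "X (p * q) * X 1 = X (p * a) * X (p * q) - monom 1 1 * (X (p * q) * X (q * b))"
    by (simp only:) (simp only: algebra_simps)
  moreover have "X p * X q dvd X (p * a) * X (p * q)"
    using X_dvd[of p a] X_dvd[of q p] by (simp add: mult_dvd_mono mult.commute)
  moreover have "X p * X q dvd monom 1 1 * (X (p * q) * X (q * b))"
    by (intro dvd_mult mult_dvd_mono X_dvd)
  ultimately show ?thesis
    unfolding Q_denom_def Q_numer_def by (simp add: X_def[symmetric] dvd_diff)
qed

lemma Q_poly_mult_denom:
  fixes p q :: nat
  assumes "p > 1" "q > 1" "coprime p q"
  shows "Q_poly p q * Q_denom p q = Q_numer p q"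
  using Q_denom_dvd_numer[OF assms] by (simp add: Q_poly_def)

end

theory Submission
  imports Defs
begin

text \<open>Let \<open>S\<close> be the numerical semigroup generated by \<open>p\<close> and \<open>q\<close>. As a power series,
  \<open>Q\<^sub>p\<^sub>q = (1 - x) * (\<Sum>s\<in>S. x ^ s)\<close>, so the exponents of \<open>Q\<^sub>p\<^sub>q\<close> are the places where membership
  in \<open>S\<close> changes, and its gaps are the lengths of the bounded runs of elements and of
  non-elements of \<open>S\<close>. Put \<open>m = min p q\<close>. A run of non-elements contains no multiple of \<open>m\<close>, and
  a run of \<open>m\<close> elements never ends because \<open>S + m \<subseteq> S\<close>; so no gap exceeds \<open>m - 1\<close>.
  The run \<open>1, \<dots>, m - 1\<close> of non-elements attains this value.\<close>

text \<open>This replaces list indices by pairs of nonzero coefficients with only zeros between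
  them: \<open>exponents f\<close> lists the support in strictly increasing order, so such pairs are
  exactly its neighbouring entries. The pair \<open>a\<close>, \<open>b\<close> attains
  \<open>d\<close>, and \<open>bound\<close> makes \<open>d\<close> maximal.\<close>

lemma max_gap_eqI:
  fixes f :: "'a::zero poly"
  assumes a: "coeff f a \<noteq> 0" and b: "coeff f b \<noteq> 0" and "a < b" and "b - a = d"
    and between: "\<And>c. a < c \<Longrightarrow> c < b \<Longrightarrow> coeff f c = 0"
    and bound: "\<And>a b. coeff f a \<noteq> 0 \<Longrightarrow> coeff f b \<noteq> 0 \<Longrightarrow> a < b \<Longrightarrow>
      (\<And>c. a < c \<Longrightarrow> c < b \<Longrightarrow> coeff f c = 0) \<Longrightarrow> b - a \<le> d"
  shows "max_gap f = d"
proof -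
  define E where "E = {e. coeff f e \<noteq> 0}"
  define xs where "xs = exponents f"
  have "E \<subseteq> {..degree f}"
    by (auto simp: E_def intro: le_degree)
  then have "finite E"
    using finite_subset by blast
  then have set_xs: "set xs = E" and sorted: "sorted_wrt (<) xs"
    by (simp_all add: xs_def exponents_def E_def)
  have less: "xs ! i < xs ! j \<longleftrightarrow> i < j" if "i < length xs" "j < length xs" for i j
    using sorted_wrt_nth_less[OF sorted] that by (metis linorder_neqE_nat order_less_asym order_less_irrefl)
  have index: "\<exists>i<length xs. xs ! i = e" if "coeff f e \<noteq> 0" for e
    using that set_xs unfolding E_def by (simp add: in_set_conv_nth[symmetric])
  obtain i where i: "i < length xs" "xs ! i = a"
    using index[OF a] by blast
  obtain j where j: "j < length xs" "xs ! j = b"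
    using index[OF b] by blast
  have "i < j"
    using less i j \<open>a < b\<close> by blast
  moreover have "\<not> i + 1 < j"
  proof
    assume "i + 1 < j"
    then have "a < xs ! (i + 1)" "xs ! (i + 1) < b"
      using i j less[of i "i + 1"] less[of "i + 1" j] by auto
    moreover have "xs ! (i + 1) \<in> E"
      using \<open>i + 1 < j\<close> j(1) set_xs nth_mem by (metis order_less_trans)
    ultimately show False
      using between by (auto simp: E_def)
  qed
  ultimately have "j = i + 1"
    by simp
  let ?G = "{xs ! (i + 1) - xs ! i | i. i + 1 < length xs}"
  have "Max ?G = d"
  proof (rule Max_eqI)
    show "finite ?G"
      by (rule finite_image_set, rule finite_subset[of _ "{..<length xs}"]) auto
    show "d \<in> ?G"
      using i j \<open>j = i + 1\<close> \<open>b - a = d\<close> by blast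
    fix y assume "y \<in> ?G"
    then obtain k where k: "k + 1 < length xs" "y = xs ! (k + 1) - xs ! k"
      by blast
    have "coeff f c = 0" if c: "xs ! k < c" "c < xs ! (k + 1)" for c
    proof (rule ccontr)
      assume "coeff f c \<noteq> 0"
      then obtain l where "l < length xs" "xs ! l = c"
        using index by blast
      then show False
        using c k less[of k l] less[of l "k + 1"] by auto
    qed
    moreover have "xs ! k \<in> E" "xs ! (k + 1) \<in> E"
      using k(1) set_xs nth_mem[of k xs] nth_mem[of "k + 1" xs] by auto
    ultimately show "y \<le> d"
      unfolding k(2) using less[of k "k + 1"] k(1) by (intro bound) (auto simp: E_def)
  qed
  moreover have "\<not> length xs \<le> 1"
    using j(1) \<open>j = i + 1\<close> by simp
  ultimately show ?thesis
    by (simp add: max_gap_def xs_def)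
qed

definition semigroup2 :: "nat \<Rightarrow> nat \<Rightarrow> nat set" where
  "semigroup2 p q = {p * x + q * y | x y. True}"

lemma mult_min_in_semigroup2: "min p q * k \<in> semigroup2 p q"
proof (cases "p \<le> q")
  case True
  then have "min p q * k = p * k + q * 0" by simp
  then show ?thesis unfolding semigroup2_def by blast
next
  case False
  then have "min p q * k = p * 0 + q * k" by simp
  then show ?thesis unfolding semigroup2_def by blast
qed

lemma semigroup2_add:
  assumes "m \<in> semigroup2 p q" "n \<in> semigroup2 p q"
  shows "m + n \<in> semigroup2 p q"
proof -
  obtain x y x' y' where "m = p * x + q * y" "n = p * x' + q * y'"
    using assms by (auto simp: semigroup2_def)
  then have "m + n = p * (x + x') + q * (y + y')"
    by (simp add: algebra_simps)
  then show ?thesis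
    unfolding semigroup2_def by blast
qed

lemma semigroup2_less_min:
  assumes "n \<in> semigroup2 p q" "n < min p q"
  shows "n = 0"
proof -
  obtain x y where n: "n = p * x + q * y"
    using assms(1) by (auto simp: semigroup2_def)
  have "x = 0"
    using assms(2) n by (cases x) auto
  moreover have "y = 0"
    using assms(2) n by (cases y) auto
  ultimately show ?thesis
    using n by simp
qed

text \<open>The left side describes the Apery set of the semigroup with respect to \<open>q\<close>.
  A representation with \<open>y > 0\<close> or \<open>x \<ge> q\<close> allows \<open>q\<close> to
  be subtracted; conversely, coprimality rules out subtracting \<open>q\<close> from
  \<open>p * x\<close> when \<open>x < q\<close>.\<close>

lemma semigroup2_Apery:
  assumes "p > 0" "q > 0" "coprime p q"
  shows "n \<in> semigroup2 p q \<and> \<not> (q \<le> n \<and> n - q \<in> semigroup2 p q) \<longleftrightarrow> (\<exists>x<q. n = p * x)"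
proof
  assume L: "n \<in> semigroup2 p q \<and> \<not> (q \<le> n \<and> n - q \<in> semigroup2 p q)"
  then obtain x y where n: "n = p * x + q * y"
    by (auto simp: semigroup2_def)
  have "y = 0"
  proof (rule ccontr)
    assume "y \<noteq> 0"
    then obtain z where "y = Suc z"
      by (cases y) auto
    then have "q \<le> n" "n - q = p * x + q * z"
      using n by auto
    then show False
      using L unfolding semigroup2_def by blast
  qed
  moreover have "x < q"
  proof (rule ccontr)
    assume "\<not> x < q"
    then obtain z where "x = q + z"
      by (metis le_Suc_ex not_less)
    \<comment> \<open>The summand \<open>p * q\<close> of \<open>p * x\<close> is read as
      \<open>p\<close> copies of \<open>q\<close>; one is split off and \<open>r\<close>
      remain.\<close>
    moreover obtain r where "p = Suc r"
      using assms(1) by (cases p) auto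
    ultimately have "n = q + (p * z + q * (r + y))"
      using n by (simp add: algebra_simps)
    then have "q \<le> n" "n - q = p * z + q * (r + y)"
      by auto
    then show False
      using L unfolding semigroup2_def by blast
  qed
  ultimately show "\<exists>x<q. n = p * x"
    using n by auto
next
  assume "\<exists>x<q. n = p * x"
  then obtain x where x: "x < q" "n = p * x"
    by blast
  have "n = p * x + q * 0"
    using x by simp
  then have "n \<in> semigroup2 p q"
    unfolding semigroup2_def by blast
  moreover have False if le: "q \<le> n" and mem: "n - q \<in> semigroup2 p q"
  proof -
    obtain a b where "n - q = p * a + q * b"
      using mem by (auto simp: semigroup2_def)
    then have eq: "p * x = p * a + q * Suc b"
      using le x by simp
    \<comment> \<open>This gives \<open>0 < x - a < q\<close>, too small for a multiple of
      \<open>q\<close>.\<close>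
    then have "p * a < p * x"
      using assms(2) by simp
    then have "a < x"
      by simp
    have "p * (x - a) = q * Suc b"
      using eq by (simp add: diff_mult_distrib2)
    then have "q dvd p * (x - a)"
      by simp
    then have "q dvd x - a"
      using assms(3) by (simp add: coprime_commute coprime_dvd_mult_right_iff)
    then show False
      using \<open>a < x\<close> x(1) by (auto dest: dvd_imp_le)
  qed
  ultimately show "n \<in> semigroup2 p q \<and> \<not> (q \<le> n \<and> n - q \<in> semigroup2 p q)"
    by blast
qed

definition semigroup2_fps :: "nat \<Rightarrow> nat \<Rightarrow> int fps" where
  "semigroup2_fps p q = Abs_fps (\<lambda>n. of_bool (n \<in> semigroup2 p q))"

text \<open>The factor \<open>1 - fps_X ^ q\<close> cancels each element \<open>n\<close> with
  \<open>n - q\<close> also in the semigroup, so only the Apery set survives.\<close>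

lemma semigroup2_fps_mult:
  assumes "p > 0" "q > 0" "coprime p q"
  shows "semigroup2_fps p q * (1 - fps_X ^ q) = (\<Sum>x<q. (fps_X ^ p) ^ x)"
proof (rule fps_ext)
  fix n
  \<comment> \<open>Closure under adding \<open>q\<close> excludes the coefficient \<open>-1\<close>
    in the difference of the two indicators.\<close>
  have "n \<in> semigroup2 p q" if "q \<le> n" "n - q \<in> semigroup2 p q"
  proof -
    have "q = p * 0 + q * 1" by simp
    then have "q \<in> semigroup2 p q"
      unfolding semigroup2_def by blast
    then show ?thesis
      using semigroup2_add that by fastforce
  qed
  then have "fps_nth (semigroup2_fps p q * (1 - fps_X ^ q)) n = of_bool (\<exists>x<q. n = p * x)"
    unfolding semigroup2_Apery[OF assms, symmetric]
    by (auto simp: semigroup2_fps_def right_diff_distrib fps_X_power_mult_right_nth)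
  also have "\<dots> = (\<Sum>x<q. of_bool (n = p * x))"
  proof (cases "\<exists>x<q. n = p * x")
    case True
    then obtain x where x: "x < q" "n = p * x"
      by blast
    then have "(\<Sum>y<q. of_bool (n = p * y)) = (\<Sum>y<q. if x = y then 1 else (0::int))"
      using assms(1) by (intro sum.cong) auto
    then show ?thesis
      using x by auto
  next
    case False
    then show ?thesis
      by (auto intro!: sum.neutral[symmetric])
  qed
  also have "\<dots> = fps_nth (\<Sum>x<q. (fps_X ^ p) ^ x) n"
    by (simp add: fps_sum_nth power_mult[symmetric] fps_X_power_nth of_bool_def)
  finally show "fps_nth (semigroup2_fps p q * (1 - fps_X ^ q)) n
      = fps_nth (\<Sum>x<q. (fps_X ^ p) ^ x) n" .
qed

text \<open>Both sides agree after multiplication by the nonzero series \<open>?D\<close>: the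
  numerator factor \<open>1 - (fps_X ^ p) ^ q\<close> splits off \<open>1 - fps_X ^ p\<close>, and
  the geometric sum left over is the one from \<open>semigroup2_fps_mult\<close>.\<close>

lemma fps_of_Q_poly:
  assumes "p > 1" "q > 1" "coprime p q"
  shows "fps_of_poly (Q_poly p q) = semigroup2_fps p q * (1 - fps_X)"
proof -
  let ?D = "(1 - fps_X ^ p) * (1 - fps_X ^ q) :: int fps"
  have X: "fps_of_poly (monom 1 n - 1 :: int poly) = - (1 - fps_X ^ n)" for n
    by (simp add: fps_of_poly_diff fps_of_poly_monom)
  have "?D = fps_of_poly (Q_denom p q)"
    unfolding Q_denom_def fps_of_poly_mult X by (simp only: minus_mult_minus)
  then have "fps_of_poly (Q_poly p q) * ?D = fps_of_poly (Q_numer p q)"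
    by (simp add: fps_of_poly_mult[symmetric] Q_poly_mult_denom[OF assms])
  also have "\<dots> = (1 - (fps_X ^ p) ^ q) * (1 - fps_X)"
    unfolding Q_numer_def fps_of_poly_mult X by (simp add: power_mult)
  also have "1 - (fps_X ^ p) ^ q = (1 - fps_X ^ p) * (\<Sum>x<q. (fps_X ^ p) ^ x :: int fps)"
    by (rule one_diff_power_eq)
  also have "(\<Sum>x<q. (fps_X ^ p) ^ x) = semigroup2_fps p q * (1 - fps_X ^ q)"
    using semigroup2_fps_mult[of p q] assms by simp
  finally have "fps_of_poly (Q_poly p q) * ?D = (semigroup2_fps p q * (1 - fps_X)) * ?D"
    by (simp only: mult_ac)
  moreover have "1 - fps_X ^ n \<noteq> (0 :: int fps)" if "n > 1" for n
  proof
    assume "1 - fps_X ^ n = (0 :: int fps)"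
    then have "fps_nth (1 - fps_X ^ n :: int fps) 0 = 0"
      by (simp only: fps_zero_nth)
    then show False
      using that by simp
  qed
  ultimately show ?thesis
    using assms by simp
qed

lemma coeff_Q_poly_Suc:
  assumes "p > 1" "q > 1" "coprime p q"
  shows "coeff (Q_poly p q) (Suc n)
    = of_bool (Suc n \<in> semigroup2 p q) - of_bool (n \<in> semigroup2 p q)"
proof -
  have "coeff (Q_poly p q) (Suc n) = fps_nth (semigroup2_fps p q * (1 - fps_X)) (Suc n)"
    using fps_of_Q_poly[OF assms] by (metis fps_of_poly_nth)
  then show ?thesis
    by (simp add: right_diff_distrib semigroup2_fps_def)
qed

theorem theorem9:
  fixes p q :: nat
  assumes "p > 1" and "q > 1" and "coprime p q"
  shows "max_gap (Q_poly p q) = min p q - 1"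
proof -
  define S where "S = semigroup2 p q"
  define m where "m = min p q"
  have "m > 1"
    using assms by (simp add: m_def)
  have multiples: "m * k \<in> S" for k
    by (simp add: S_def m_def mult_min_in_semigroup2)
  have small: "n \<notin> S" if "0 < n" "n < m" for n
    using that semigroup2_less_min by (auto simp: S_def m_def)
  have zero: "coeff (Q_poly p q) n = 0 \<longleftrightarrow> (n \<in> S \<longleftrightarrow> n - 1 \<in> S)" if "n > 0" for n
    using that coeff_Q_poly_Suc[OF assms, of "n - 1"] by (auto simp: S_def)
  have "max_gap (Q_poly p q) = m - 1"
  proof (rule max_gap_eqI)
    \<comment> \<open>The gap from \<open>1\<close> to \<open>m\<close> is attained: membership in
      \<open>S\<close> is lost at \<open>1\<close>, regained at \<open>m\<close>, and constant in
      between.\<close>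
    show "coeff (Q_poly p q) 1 \<noteq> 0"
      using zero[of 1] small[of 1] multiples[of 0] \<open>m > 1\<close> by simp
    show "coeff (Q_poly p q) m \<noteq> 0"
      using zero[of m] small[of "m - 1"] multiples[of 1] \<open>m > 1\<close> by simp
    show "coeff (Q_poly p q) c = 0" if "1 < c" "c < m" for c
      using zero[of c] small[of c] small[of "c - 1"] that by simp
    fix a b
    assume b: "coeff (Q_poly p q) b \<noteq> 0" and "a < b"
      and between: "\<And>c. a < c \<Longrightarrow> c < b \<Longrightarrow> coeff (Q_poly p q) c = 0"
    \<comment> \<open>A zero coefficient at \<open>c > 0\<close> means that \<open>c - 1\<close> and
      \<open>c\<close> agree on membership, so membership is constant from \<open>a\<close> to
      \<open>b - 1\<close>.\<close>
    have run: "a + k \<in> S \<longleftrightarrow> a \<in> S" if "a + k < b" for k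
      using that
    proof (induction k)
      case (Suc k)
      then show ?case
        using between[of "a + Suc k"] zero[of "a + Suc k"] by simp
    qed simp
    show "b - a \<le> m - 1"
    proof (rule ccontr)
      assume "\<not> b - a \<le> m - 1"
      then have long: "a + m \<le> b"
        by simp
      \<comment> \<open>\<open>a + k\<close> is the least multiple of \<open>m\<close> that is at
        least \<open>a\<close>; the outer \<open>mod\<close> covers the case \<open>m dvd a\<close>.
        Since \<open>k < m\<close>, it lies in the run, which therefore consists of elements of
        \<open>S\<close>.\<close>
      define k where "k = (m - a mod m) mod m"
      have "k < m"
        using \<open>m > 1\<close> by (simp add: k_def)
      have "m dvd a + k"
        unfolding k_def using \<open>m > 1\<close>
        by (metis gr_implies_not0 le_add_diff_inverse less_imp_le_nat mod_0_imp_dvd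
            mod_add_left_eq mod_add_right_eq mod_less_divisor mod_self gr0I)
      then have "a + k \<in> S"
        using multiples by (auto elim!: dvdE)
      then have "a \<in> S"
        using run[of k] \<open>k < m\<close> long by simp
      \<comment> \<open>The run contains \<open>m\<close> consecutive elements of \<open>S\<close>,
        and adding \<open>m\<close> repeatedly reaches everything beyond them.\<close>
      have above: "a + n \<in> S" for n
      proof (induction n rule: less_induct)
        case (less n)
        show ?case
        proof (cases "n < m")
          case True
          then show ?thesis
            using run[of n] long \<open>a \<in> S\<close> by simp
        next
          case False
          then have "a + (n - m) \<in> S"
            using \<open>m > 1\<close> by (intro less) simp
          then have "a + (n - m) + m * 1 \<in> S"
            using multiples[of 1] semigroup2_add unfolding S_def by blast
          then show ?thesis
            using False by simp
        qed
      qed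
      \<comment> \<open>No change of membership is left at \<open>b\<close>, although its
        coefficient is nonzero.\<close>
      have "b \<in> S" "b - 1 \<in> S"
        using above[of "b - a"] above[of "b - 1 - a"] \<open>a < b\<close> by auto
      then show False
        using zero[of b] b \<open>a < b\<close> by simp
    qed
  qed (use \<open>m > 1\<close> in simp_all)
  then show ?thesis
    by (simp add: m_def)
qed

end
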